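(* Let $X$ be a real or complex Banach space. Let $I$ be a non-empty set, possibly uncountable, and let $\{C_{i}\}_{i\in I}$ be a collection of closed, not necessarily proper, cones in $X$, such that every $x\in X$ can be written as an absolutely convergent series $x=\sum_{i\in I}c_{i}$, where $c_{i}\in C_{i}$ for all $i\in I$. Let $Y=\ell^{1}(I,X)$ be the $\ell^{1}$-direct sum of $|I|$ copies of $X$, and let $C$ be the natural closed cone in the Banach space $Y$ consisting of those elements whose $i$-th component is in $C_{i}$, for all $i\in I$. Finally, let $J$ be a finite set, possibly empty, and, for all $j\in J$, let $\rho_{j}:Y\to\mathbb{R}$ be a continuous seminorm or a continuous real-linear functional. Let $S_X:=\{x\in X:\|x\|=1\}$. Then: (1) There exist a constant $K>0$ and a continuous positively homogeneous map $\gamma:X\to C$ with continuous positively homogeneous component maps $\gamma_{i}:X\to C_{i}$ $(i\in I)$ such that: (a) $x=\sum_{i\in I}\gamma_{i}(x)$ for all $x\in X$; (b) $\sum_{i\in I}\|\gamma_{i}(x)\|\leq K\|x\|$ for all $x\in X$. (2) If $K>0$ and $\alpha_{j}\in\mathbb{R}$ $(j\in J)$ are constants, then the following are equivalent: (a) For every $\varepsilon>0$, there exists a map $\gamma_{\varepsilon}:S_{X}\to C$ with component maps $\gamma_{\varepsilon,i}:S_{X}\to C_{i}$ $(i\in I)$ such that: (i) $x=\sum_{i\in I}\gamma_{\varepsilon,i}(x)$ for all $x\in S_{X}$; (ii) $\sum_{i\in I}\|\gamma_{\varepsilon,i}(x)\|\leq K+\varepsilon$ for all $x\in S_{X}$;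 (iii) $\rho_{j}(\gamma_{\varepsilon}(x))\leq\alpha_{j}+\varepsilon$ for all $x\in S_{X}$ and $j\in J$. (b) For every $\varepsilon>0$, there exists a continuous positively homogeneous map $\gamma_{\varepsilon}:X\to C$ with continuous positively homogeneous component maps $\gamma_{\varepsilon,i}:X\to C_{i}$ $(i\in I)$ such that: (i) $x=\sum_{i\in I}\gamma_{\varepsilon,i}(x)$ for all $x\in X$; (ii) $\sum_{i\in I}\|\gamma_{\varepsilon,i}(x)\|\leq(K+\varepsilon)\|x\|$ for all $x\in X$; (iii) $\rho_{j}(\gamma_{\varepsilon}(x))\leq(\alpha_{j}+\varepsilon)\|x\|$ for all $x\in X$ and $j\in J$.
   Context: A subset $C$ of a real or complex vector space is a cone if $C+C\subseteq C$ and $\lambda C\subseteq C$ for all real $\lambda\geq 0$; it is proper if $C\cap(-C)=\{0\}$ (not assumed here). A series $\sum_{i\in I}c_i$ is absolutely convergent if $\sum_{i\in I}\|c_i\|<\infty$. $\ell^1(I,X)$ is the Banach space of families $(x_i)_{i\in I}$ in $X$ with norm $\sum_{i\in I}\|x_i\|<\infty$. A map $\gamma$ on $X$ is positively homogeneous if $\gamma(\lambda x)=\lambda\gamma(x)$ for all $x\in X$ and real $\lambda\geq0$. The component maps of $\gamma:X\to C\subseteq\ell^1(I,X)$ are the maps $\gamma_i$ with $\gamma(x)=(\gamma_i(x))_{i\in I}$. *)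

theory Defs
  imports "HOL-Analysis.Analysis"
begin

text \<open>
  Everything below uses only the real-linear structure of the space (cones, positive homogeneity
  and real-linear functionals refer to real scalars). A complex Banach space is covered by
  regarding it as a real one: the norm is unchanged, and a complex seminorm is a real seminorm.
\<close>

text \<open>The Banach space \<open>\<ell>\<^sup>1(I, X)\<close>; the index set is the (arbitrary, nonempty) type \<open>'i\<close>.\<close>

typedef (overloaded) ('i, 'a::real_normed_vector) ell1 =
  "{f :: 'i \<Rightarrow> 'a. (\<lambda>i. norm (f i)) summable_on UNIV}"
  morphisms ell1_nth Abs_ell1
  by (rule exI[of _ "\<lambda>_. 0"]) simp

lemma ell1_summable: "(\<lambda>i. norm (ell1_nth y i)) summable_on UNIV"
  using ell1_nth[of y] by simp

lemma ell1_nth_Abs: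
  "(\<lambda>i. norm (f i)) summable_on UNIV \<Longrightarrow> ell1_nth (Abs_ell1 f) = f"
  by (simp add: Abs_ell1_inverse)

lemma ell1_eqI: "(\<And>i. ell1_nth x i = ell1_nth y i) \<Longrightarrow> x = y"
  by (metis ell1_nth_inject ext)

lemma norm_summable_add:
  assumes "(\<lambda>i. norm (f i :: 'a::real_normed_vector)) summable_on A"
    and "(\<lambda>i. norm (g i)) summable_on A"
  shows "(\<lambda>i. norm (f i + g i)) summable_on A"
  by (rule summable_on_comparison_test[OF summable_on_add[OF assms]]) (auto intro: norm_triangle_ineq)

lemma norm_summable_scaleR:
  assumes "(\<lambda>i. norm (f i :: 'a::real_normed_vector)) summable_on A"
  shows "(\<lambda>i. norm (c *\<^sub>R f i)) summable_on A"
  using summable_on_cmult_right[OF assms, of "\<bar>c\<bar>"] by simp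

lemma norm_summable_diff:
  assumes "(\<lambda>i. norm (f i :: 'a::real_normed_vector)) summable_on A"
    and "(\<lambda>i. norm (g i)) summable_on A"
  shows "(\<lambda>i. norm (f i - g i)) summable_on A"
  using norm_summable_add[of f A "\<lambda>i. - g i"] assms by simp

instantiation ell1 :: (type, real_normed_vector) real_normed_vector
begin

definition "0 = Abs_ell1 (\<lambda>_. 0)"
definition "x + y = Abs_ell1 (\<lambda>i. ell1_nth x i + ell1_nth y i)"
definition "x - y = Abs_ell1 (\<lambda>i. ell1_nth x i - ell1_nth y i)"
definition "- x = Abs_ell1 (\<lambda>i. - ell1_nth x i)"
definition "c *\<^sub>R x = Abs_ell1 (\<lambda>i. c *\<^sub>R ell1_nth x i)"
definition norm_ell1_def: "norm x = (\<Sum>\<^sub>\<infinity>i. norm (ell1_nth x i))"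
definition "sgn (x :: ('a, 'b) ell1) = inverse (norm x) *\<^sub>R x"
definition "dist (x :: ('a, 'b) ell1) y = norm (x - y)"
definition [code del]:
  "(uniformity :: (('a, 'b) ell1 \<times> ('a, 'b) ell1) filter) =
     (INF e\<in>{0<..}. principal {(x, y). dist x y < e})"
definition [code del]:
  "open (U :: ('a, 'b) ell1 set) \<longleftrightarrow>
     (\<forall>x\<in>U. eventually (\<lambda>(x', y). x' = x \<longrightarrow> y \<in> U) uniformity)"

lemma ell1_nth_ops:
  "ell1_nth 0 = (\<lambda>_. 0)"
  "ell1_nth (x + y) = (\<lambda>i. ell1_nth x i + ell1_nth y i)"
  "ell1_nth (x - y) = (\<lambda>i. ell1_nth x i - ell1_nth y i)"
  "ell1_nth (- x) = (\<lambda>i. - ell1_nth x i)"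
  "ell1_nth (c *\<^sub>R x) = (\<lambda>i. c *\<^sub>R ell1_nth x i)"
proof -
  show "ell1_nth 0 = (\<lambda>_. 0)"
    unfolding zero_ell1_def by (rule ell1_nth_Abs) simp
  show "ell1_nth (x + y) = (\<lambda>i. ell1_nth x i + ell1_nth y i)"
    unfolding plus_ell1_def by (intro ell1_nth_Abs norm_summable_add ell1_summable)
  show "ell1_nth (x - y) = (\<lambda>i. ell1_nth x i - ell1_nth y i)"
    unfolding minus_ell1_def by (intro ell1_nth_Abs norm_summable_diff ell1_summable)
  show "ell1_nth (- x) = (\<lambda>i. - ell1_nth x i)"
    unfolding uminus_ell1_def using ell1_summable[of x] by (intro ell1_nth_Abs) simp
  show "ell1_nth (c *\<^sub>R x) = (\<lambda>i. c *\<^sub>R ell1_nth x i)"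
    unfolding scaleR_ell1_def by (intro ell1_nth_Abs norm_summable_scaleR ell1_summable)
qed

instance
proof
  fix x y z :: "('a, 'b) ell1" and a b :: real and U :: "('a, 'b) ell1 set"
  show "x + y + z = x + (y + z)" "x + y = y + x" "0 + x = x" "- x + x = 0" "x - y = x + - y"
    by (rule ell1_eqI; simp add: ell1_nth_ops algebra_simps)+
  show "a *\<^sub>R (x + y) = a *\<^sub>R x + a *\<^sub>R y" "(a + b) *\<^sub>R x = a *\<^sub>R x + b *\<^sub>R x"
    "a *\<^sub>R b *\<^sub>R x = (a * b) *\<^sub>R x" "1 *\<^sub>R x = x"
    by (rule ell1_eqI; simp add: ell1_nth_ops algebra_simps)+
  show "dist x y = norm (x - y)" by (rule dist_ell1_def)
  show "sgn x = inverse (norm x) *\<^sub>R x" by (rule sgn_ell1_def)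
  show "uniformity = (INF e\<in>{0<..}. principal {(x :: ('a, 'b) ell1, y). dist x y < e})"
    by (rule uniformity_ell1_def)
  show "open U \<longleftrightarrow> (\<forall>x\<in>U. eventually (\<lambda>(x', y). x' = x \<longrightarrow> y \<in> U) uniformity)"
    by (rule open_ell1_def)
  show "norm x = 0 \<longleftrightarrow> x = 0"
  proof
    assume "norm x = 0"
    then have "norm (ell1_nth x i) = 0" for i
      using nonneg_infsum_le_0D[OF _ ell1_summable[of x], of i] by (simp add: norm_ell1_def)
    then show "x = 0" by (intro ell1_eqI) (simp add: ell1_nth_ops)
  qed (simp add: norm_ell1_def ell1_nth_ops)
  show "norm (x + y) \<le> norm x + norm y"
    unfolding norm_ell1_def ell1_nth_ops infsum_add[OF ell1_summable ell1_summable, symmetric]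
    by (intro infsum_mono norm_summable_add summable_on_add ell1_summable norm_triangle_ineq)
  show "norm (a *\<^sub>R x) = \<bar>a\<bar> * norm x"
    unfolding norm_ell1_def ell1_nth_ops by (simp add: infsum_cmult_right')
qed

end

lemma sum_norm_le_norm_ell1: "finite F \<Longrightarrow> (\<Sum>i\<in>F. norm (ell1_nth x i)) \<le> norm x"
  unfolding norm_ell1_def by (rule finite_sum_le_infsum[OF ell1_summable]) auto

lemma norm_ell1_nth_le: "norm (ell1_nth x i) \<le> norm x"
  using sum_norm_le_norm_ell1[of "{i}" x] by simp

instance ell1 :: (type, banach) banach
proof
  fix X :: "nat \<Rightarrow> ('a, 'b) ell1"
  assume C: "Cauchy X"
  have "Cauchy (\<lambda>n. ell1_nth (X n) i)" for i
  proof (rule CauchyI)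
    fix e :: real assume "e > 0"
    then obtain M where M: "\<And>m n. m \<ge> M \<Longrightarrow> n \<ge> M \<Longrightarrow> norm (X m - X n) < e"
      using CauchyD[OF C] by blast
    have "norm (ell1_nth (X m) i - ell1_nth (X n) i) \<le> norm (X m - X n)" for m n
      using norm_ell1_nth_le[of "X m - X n" i] by (simp add: ell1_nth_ops)
    then show "\<exists>M. \<forall>m\<ge>M. \<forall>n\<ge>M. norm (ell1_nth (X m) i - ell1_nth (X n) i) < e"
      using M by (meson le_less_trans)
  qed
  then have "\<exists>l. (\<lambda>n. ell1_nth (X n) i) \<longlonglongrightarrow> l" for i
    using Cauchy_convergent convergent_def by blast
  then obtain f where f: "\<And>i. (\<lambda>n. ell1_nth (X n) i) \<longlonglongrightarrow> f i"
    by metis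
  have bound: "\<exists>M. \<forall>n\<ge>M. \<forall>F. finite F \<longrightarrow> (\<Sum>i\<in>F. norm (ell1_nth (X n) i - f i)) \<le> e"
    if "e > 0" for e
  proof -
    obtain M where M: "\<And>m n. m \<ge> M \<Longrightarrow> n \<ge> M \<Longrightarrow> norm (X m - X n) < e"
      using CauchyD[OF C \<open>e > 0\<close>] by blast
    have "(\<Sum>i\<in>F. norm (ell1_nth (X n) i - f i)) \<le> e" if "n \<ge> M" "finite F" for n F
    proof (rule tendsto_upperbound)
      show "(\<lambda>m. \<Sum>i\<in>F. norm (ell1_nth (X n) i - ell1_nth (X m) i))
              \<longlonglongrightarrow> (\<Sum>i\<in>F. norm (ell1_nth (X n) i - f i))"
        by (intro tendsto_intros f)
      have "(\<Sum>i\<in>F. norm (ell1_nth (X n) i - ell1_nth (X m) i)) \<le> e" if "m \<ge> M" for m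
        using sum_norm_le_norm_ell1[OF \<open>finite F\<close>, of "X n - X m"] M[OF \<open>n \<ge> M\<close> that]
        by (simp add: ell1_nth_ops)
      then show "\<forall>\<^sub>F m in sequentially. (\<Sum>i\<in>F. norm (ell1_nth (X n) i - ell1_nth (X m) i)) \<le> e"
        unfolding eventually_sequentially by blast
    qed simp
    then show ?thesis by blast
  qed
  have summ: "(\<lambda>i. norm (ell1_nth (X n) i - f i)) summable_on UNIV"
    if "\<forall>F. finite F \<longrightarrow> (\<Sum>i\<in>F. norm (ell1_nth (X n) i - f i)) \<le> e" for n e
    by (rule nonneg_bdd_above_summable_on) (use that in \<open>auto simp: bdd_above_def\<close>)
  obtain N where "\<forall>F. finite F \<longrightarrow> (\<Sum>i\<in>F. norm (ell1_nth (X N) i - f i)) \<le> 1"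
    using bound[of 1] by auto
  from norm_summable_diff[OF ell1_summable[of "X N"] summ[OF this]]
  have fs: "ell1_nth (Abs_ell1 f) = f"
    by (intro ell1_nth_Abs) simp
  have "X \<longlonglongrightarrow> Abs_ell1 f"
  proof (rule LIMSEQ_I)
    fix r :: real assume "r > 0"
    then obtain M where M: "\<And>n F. n \<ge> M \<Longrightarrow> finite F \<Longrightarrow> (\<Sum>i\<in>F. norm (ell1_nth (X n) i - f i)) \<le> r / 2"
      using bound[of "r / 2"] by auto
    have "norm (X n - Abs_ell1 f) \<le> r / 2" if "n \<ge> M" for n
      unfolding norm_ell1_def ell1_nth_ops fs
      by (rule infsum_le_finite_sums[OF summ[of _ "r / 2"]]) (use M that in blast)+
    then show "\<exists>no. \<forall>n\<ge>no. norm (X n - Abs_ell1 f) < r"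
      using \<open>r > 0\<close> by (intro exI[of _ M]) force
  qed
  then show "convergent X" by (auto simp: convergent_def)
qed

text \<open>
  A cone in the sense used here is closed under addition as well; the predicate \<^const>\<open>cone\<close>
  of the library only asks for closure under scaling by nonnegative reals.
\<close>

definition additive_cone :: "'a::real_vector set \<Rightarrow> bool" where
  "additive_cone C \<longleftrightarrow> (\<forall>x\<in>C. \<forall>y\<in>C. x + y \<in> C) \<and> cone C"

definition ell1_cone :: "('i \<Rightarrow> 'a::real_normed_vector set) \<Rightarrow> ('i, 'a) ell1 set" where
  "ell1_cone C = {y. \<forall>i. ell1_nth y i \<in> C i}"

definition pos_homogeneous :: "('a::real_vector \<Rightarrow> 'b::real_vector) \<Rightarrow> bool" where
  "pos_homogeneous \<gamma> \<longleftrightarrow> (\<forall>c\<ge>0. \<forall>x. \<gamma> (c *\<^sub>R x) = c *\<^sub>R \<gamma> x)"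

definition is_seminorm :: "('a::real_vector \<Rightarrow> real) \<Rightarrow> bool" where
  "is_seminorm p \<longleftrightarrow>
     (\<forall>x. 0 \<le> p x) \<and> (\<forall>c x. p (c *\<^sub>R x) = \<bar>c\<bar> * p x) \<and> (\<forall>x y. p (x + y) \<le> p x + p y)"

end

theory Submission
  imports Defs
begin

text \<open>
  Let \<open>T\<close> be the bounded linear map that sends a family in \<open>\<ell>\<^sup>1(I, X)\<close> to its sum and let \<open>D\<close> be the
  closed cone of the families with all components in the given cones. A continuous decomposition
  is a continuous positively homogeneous right inverse of \<open>T\<close> with values in \<open>D\<close>. By hypothesis \<open>T\<close>
  maps \<open>D\<close> onto \<open>X\<close>, and what has to be shown is that preimages can be chosen continuously without
  giving up more than \<open>\<epsilon>\<close> in the bounds on the norm and on the functionals.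

  The usual route combines an open mapping theorem for cones with Michael's selection theorem. Here
  both are replaced by a single procedure, \<open>continuous_right_inverse_in_cone\<close>. Start with any map
  \<open>g\<close> from the unit sphere to \<open>D\<close> that inverts \<open>T\<close> up to an error \<open>\<eta> < 1\<close>, and average it with a
  partition of unity whose members live on balls of a small radius \<open>\<delta>\<close>
  (\<open>partition_of_unity_by_balls\<close>). The average is continuous
  (\<open>continuous_on_convex_combination\<close>), it stays in the convex set \<open>D\<close>, it satisfies every bound on
  sublinear functionals that \<open>g\<close> satisfies (\<open>sublinear_convex_combination_le\<close>), and it inverts \<open>T\<close>
  up to the error \<open>\<eta> + \<delta>\<close>. After positively homogeneous extension, the remaining error is fed back
  into the same map again and again; the resulting series is a continuous exact right inverse
  (\<open>correct_approximate_right_inverse\<close>).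

  For the existence of a bounded decomposition, the map \<open>g\<close> with \<open>\<eta> = 1 / 2\<close> comes from the Baire
  category theorem (\<open>surjective_on_cone_approximate_preimages\<close>). For the equivalence, the given
  decomposition on the sphere is exact, so that \<open>\<eta> = 0\<close>, and the losses become arbitrarily small
  with \<open>\<delta>\<close>; the converse implication is restriction to the sphere.
\<close>

section \<open>Continuous partitions of unity on a metric space\<close>

text \<open>
  This is the supremum over \<open>a \<in> A\<close> of the tents \<open>max 0 (1 - dist x a / d)\<close>. The case
  \<open>A = {}\<close> is separate because the infimal distance to the empty set is 0 by convention, whereas
  the empty supremum has to be 0.
\<close>

definition proximity :: "real \<Rightarrow> 'a::metric_space set \<Rightarrow> 'a \<Rightarrow> real" where
  "proximity d A x = (if A = {} then 0 else max 0 (1 - infdist x A / d))"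

lemma proximity_nonneg: "0 \<le> proximity d A x"
  by (simp add: proximity_def)

lemma proximity_insert:
  assumes "d > 0"
  shows "proximity d (insert s A) x = max (proximity d A x) (max 0 (1 - dist x s / d))"
proof (cases "A = {}")
  case False
  have "infdist x (insert s A) = min (dist x s) (infdist x A)"
    using infdist_Un_min[of "{s}" A x] False by simp
  then show ?thesis
    using False assms by (auto simp: proximity_def min_def max_def field_simps)
qed (simp add: proximity_def)

lemma proximity_self: "d > 0 \<Longrightarrow> x \<in> A \<Longrightarrow> proximity d A x = 1"
  by (auto simp: proximity_def)

lemma proximity_mono:
  assumes "d > 0" "A \<subseteq> B"
  shows "proximity d A x \<le> proximity d B x"
proof (cases "A = {}")
  case False
  then have "infdist x B / d \<le> infdist x A / d"
    using assms by (intro divide_right_mono infdist_mono) auto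
  then show ?thesis using False assms by (auto simp: proximity_def)
qed (simp add: proximity_def)

lemma continuous_on_proximity: "d > 0 \<Longrightarrow> continuous_on T (proximity d A)"
  unfolding proximity_def by (cases "A = {}") (auto intro!: continuous_intros)

lemma proximity_approx:
  assumes "d > 0" "e > 0" "proximity d A x > 0"
  obtains a where "a \<in> A" "1 - dist x a / d > proximity d A x - e"
proof -
  have "A \<noteq> {}" using assms(3) by (auto simp: proximity_def)
  moreover have "infdist x A < infdist x A + d * e"
    using assms by simp
  ultimately obtain a where a: "a \<in> A" "dist x a < infdist x A + d * e"
    unfolding infdist_notempty[OF \<open>A \<noteq> {}\<close>] by (metis (no_types, lifting) cInf_lessD imageE image_is_empty)
  have "proximity d A x = 1 - infdist x A / d"
    using assms(3) by (auto simp: proximity_def split: if_splits)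
  then show ?thesis
    using a \<open>d > 0\<close> by (intro that[of a]) (auto simp: field_simps)
qed

lemma nonneg_has_sumI_approx:
  fixes f :: "'i \<Rightarrow> real"
  assumes nonneg: "\<And>i. i \<in> A \<Longrightarrow> 0 \<le> f i"
    and upper: "\<And>F. finite F \<Longrightarrow> F \<subseteq> A \<Longrightarrow> sum f F \<le> a"
    and lower: "\<And>e. e > 0 \<Longrightarrow> \<exists>B b. B \<subseteq> A \<and> (f has_sum b) B \<and> a - e \<le> b"
  shows "(f has_sum a) A"
proof -
  have summ: "f summable_on A"
    using nonneg upper by (intro nonneg_bdd_above_summable_on) (auto simp: bdd_above_def)
  have "infsum f A \<le> a"
    using summ upper by (rule infsum_le_finite_sums)
  moreover have "a \<le> infsum f A"
  proof (rule field_le_epsilon)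
    fix e :: real assume "e > 0"
    then obtain B b where "B \<subseteq> A" "(f has_sum b) B" "a - e \<le> b"
      using lower by blast
    moreover have "b \<le> infsum f A"
      using calculation nonneg by (intro has_sum_mono_neutral[OF _ has_sum_infsum[OF summ]]) auto
    ultimately show "a \<le> infsum f A + e" by linarith
  qed
  ultimately show ?thesis
    using summ by (metis antisym has_sum_infsum)
qed

text \<open>
  Paracompactness of metric spaces is bypassed by a telescoping argument. Well-order \<open>S\<close> and let
  \<open>w s\<close> be the increase of the supremum of the tents centred at the predecessors of \<open>s\<close> when the
  tent at \<open>s\<close> is added. The supremum can only increase where the new tent is positive, that is
  within distance \<open>d\<close> of \<open>s\<close>. By transfinite induction the increases up to \<open>s\<close> add up to the
  supremum up to \<open>s\<close>, and once the point \<open>x\<close> itself has been passed the supremum at \<open>x\<close> has its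
  maximal value 1. The supports need not be locally finite; the pointwise sums are merely
  convergent, and that is enough below.
\<close>

lemma partition_of_unity_by_balls:
  fixes S :: "'a::metric_space set" and d :: real
  assumes "d > 0"
  obtains w :: "'a \<Rightarrow> 'a \<Rightarrow> real"
  where "\<And>s x. 0 \<le> w s x"
    and "\<And>s x. w s x > 0 \<Longrightarrow> dist x s < d"
    and "\<And>s T. continuous_on T (w s)"
    and "\<And>x. x \<in> S \<Longrightarrow> ((\<lambda>s. w s x) has_sum 1) S"
proof -
  obtain r where "well_order_on S r"
    using well_order_on by blast
  then have trans: "trans r" and total: "total_on S r" and wf: "wf (r - Id)" and anti: "antisym r"
    by (auto simp: order_on_defs)
  define L where "L s = {t \<in> S. (t, s) \<in> r - Id}" for s
  define w where "w s x = proximity d (insert s (L s)) x - proximity d (L s) x" for s x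
  have L_trans: "insert t (L t) \<subseteq> L s" if "t \<in> L s" for s t
    using that trans anti by (auto simp: L_def dest: transD antisymD)
  have L_total: "t \<in> insert s (L s) \<or> s \<in> L t" if "s \<in> S" "t \<in> S" for s t
    using that total by (auto simp: L_def total_on_def)
  have notin: "s \<notin> L s" for s by (simp add: L_def)
  have w_nonneg: "0 \<le> w s x" for s x
    using \<open>d > 0\<close> by (simp add: w_def proximity_insert)
  have finite_max: "\<exists>t\<in>F. F \<subseteq> insert t (L t)" if "finite F" "F \<noteq> {}" "F \<subseteq> S" for F
    using that
  proof (induction rule: finite_ne_induct)
    case (insert s F)
    then obtain t where t: "t \<in> F" "F \<subseteq> insert t (L t)" by auto
    have "s \<in> S" "t \<in> S" using insert.prems t by auto
    from L_total[OF this] show ?case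
    proof
      assume "t \<in> insert s (L s)"
      then have "F \<subseteq> insert s (L s)" using t(2) L_trans[of t s] by auto
      then show ?thesis by blast
    next
      assume "s \<in> L t"
      then show ?thesis using t by blast
    qed
  qed simp
  have segment: "((\<lambda>t. w t x) has_sum proximity d (insert s (L s)) x) (insert s (L s))" 
    if "s \<in> S" for s x
    using wf that
  proof (induction s rule: wf_induct_rule)
    case (less s)
    have IH: "((\<lambda>t. w t x) has_sum proximity d (insert t (L t)) x) (insert t (L t))" if "t \<in> L s" for t
      by (rule less.IH) (use that in \<open>auto simp: L_def\<close>)
    \<comment> \<open>\<open>L s\<close> is the directed union of the initial segments that end at its members, which covers the
      successor and the limit case at once.\<close>
    have "((\<lambda>t. w t x) has_sum proximity d (L s) x) (L s)"
    proof (rule nonneg_has_sumI_approx)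
      fix F assume F: "finite F" "F \<subseteq> L s"
      show "(\<Sum>t\<in>F. w t x) \<le> proximity d (L s) x"
      proof (cases "F = {}")
        case False
        then obtain t where t: "t \<in> F" "F \<subseteq> insert t (L t)"
          using finite_max[of F] F by (auto simp: L_def)
        have "(\<Sum>t\<in>F. w t x) \<le> proximity d (insert t (L t)) x"
          using t F by (intro has_sum_mono_neutral[OF has_sum_finite IH]) (auto simp: w_nonneg)
        also have "\<dots> \<le> proximity d (L s) x"
        proof -
          have "insert t (L t) \<subseteq> L s" using t F L_trans[of t s] by blast
          then show ?thesis
            using \<open>d > 0\<close> by (intro proximity_mono)
        qed
        finally show ?thesis .
      qed (simp add: proximity_nonneg)
    next
      fix e :: real assume "e > 0"
      show "\<exists>B b. B \<subseteq> L s \<and> ((\<lambda>t. w t x) has_sum b) B \<and> proximity d (L s) x - e \<le> b"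
      proof (cases "proximity d (L s) x > 0")
        case True
        then obtain t where t: "t \<in> L s" "1 - dist x t / d > proximity d (L s) x - e"
          using proximity_approx[OF \<open>d > 0\<close> \<open>e > 0\<close>] by blast
        have "proximity d (L s) x - e \<le> proximity d (insert t (L t)) x"
          using t(2) \<open>d > 0\<close> by (simp add: proximity_insert)
        then show ?thesis
          using IH[OF t(1)] L_trans[OF t(1)] by blast
      next
        case False
        then show ?thesis
          using \<open>e > 0\<close> by (intro exI[of _ "{}"] exI[of _ 0]) auto
      qed
    qed (rule w_nonneg)
    from has_sum_insert[OF notin this] show ?case by (simp add: w_def)
  qed
  show thesis
  proof (rule that)
    show "0 \<le> w s x" for s x by (rule w_nonneg)
    show "dist x s < d" if "w s x > 0" for s x
    proof (rule ccontr)
      assume "\<not> dist x s < d"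
      then have "1 - dist x s / d \<le> 0" using \<open>d > 0\<close> by simp
      then have "w s x = 0"
        using \<open>d > 0\<close> proximity_nonneg[of d "L s" x] by (simp add: w_def proximity_insert)
      then show False using that by simp
    qed
    show "continuous_on T (w s)" for s T
      unfolding w_def by (intro continuous_intros continuous_on_proximity \<open>d > 0\<close>)
    fix x assume "x \<in> S"
    have "((\<lambda>t. w t x) has_sum 1) (insert x (L x))"
      using segment[OF \<open>x \<in> S\<close>, of x] \<open>d > 0\<close> by (simp add: proximity_self)
    also have "?this \<longleftrightarrow> ((\<lambda>t. w t x) has_sum 1) S"
    proof (rule has_sum_cong_neutral)
      fix s assume "s \<in> S - insert x (L x)"
      then have "x \<in> L s" using L_total[of x s] \<open>x \<in> S\<close> by blast
      then show "w s x = 0" using \<open>d > 0\<close> by (simp add: w_def proximity_self)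
    qed (use \<open>x \<in> S\<close> in \<open>auto simp: L_def\<close>)
    finally show "((\<lambda>t. w t x) has_sum 1) S" .
  qed
qed

section \<open>Infinite convex combinations\<close>

lemma weighted_family_summable:
  fixes v :: "'i \<Rightarrow> 'b::banach"
  assumes "(w has_sum W) A" and "\<And>i. i \<in> A \<Longrightarrow> 0 \<le> w i" and "\<And>i. i \<in> A \<Longrightarrow> norm (v i) \<le> B"
  shows "(\<lambda>i. w i *\<^sub>R v i) summable_on A"
    and "norm (\<Sum>\<^sub>\<infinity>i\<in>A. w i *\<^sub>R v i) \<le> W * B"
proof -
  have WB: "((\<lambda>i. w i * B) has_sum W * B) A"
    using assms(1) by (rule has_sum_cmult_left)
  have le: "norm (w i *\<^sub>R v i) \<le> w i * B" if "i \<in> A" for i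
    using assms(2,3)[OF that] by (simp add: mult_left_mono)
  have *: "(\<lambda>i. norm (w i *\<^sub>R v i)) summable_on A"
    using has_sum_imp_summable[OF WB] le by (rule summable_on_comparison_test) auto
  then show "(\<lambda>i. w i *\<^sub>R v i) summable_on A" by (rule abs_summable_summable)
  have "norm (\<Sum>\<^sub>\<infinity>i\<in>A. w i *\<^sub>R v i) \<le> (\<Sum>\<^sub>\<infinity>i\<in>A. norm (w i *\<^sub>R v i))"
    using * by (rule norm_infsum_bound)
  also have "\<dots> \<le> W * B"
    using le by (rule has_sum_mono[OF has_sum_infsum[OF *] WB])
  finally show "norm (\<Sum>\<^sub>\<infinity>i\<in>A. w i *\<^sub>R v i) \<le> W * B" .
qed

text \<open>
  This is the argument of Scheffe's lemma: since all weights are nonnegative and their total is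
  constantly 1, finitely many weights that carry almost all the mass at \<open>x\<^sub>0\<close> still do so near
  \<open>x\<^sub>0\<close>. Hence the tails are uniformly small near \<open>x\<^sub>0\<close> without any local finiteness.
\<close>

lemma continuous_on_convex_combination:
  fixes v :: "'i \<Rightarrow> 'b::banach" and w :: "'i \<Rightarrow> 'c::topological_space \<Rightarrow> real"
  assumes cont: "\<And>i. i \<in> A \<Longrightarrow> continuous_on S (w i)"
    and nonneg: "\<And>i x. i \<in> A \<Longrightarrow> 0 \<le> w i x"
    and unity: "\<And>x. x \<in> S \<Longrightarrow> ((\<lambda>i. w i x) has_sum 1) A"
    and bound: "\<And>i. i \<in> A \<Longrightarrow> norm (v i) \<le> B" and "0 \<le> B"
  shows "continuous_on S (\<lambda>x. \<Sum>\<^sub>\<infinity>i\<in>A. w i x *\<^sub>R v i)"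
  unfolding continuous_on_def
proof (intro ballI tendstoI)
  let ?h = "\<lambda>x. \<Sum>\<^sub>\<infinity>i\<in>A. w i x *\<^sub>R v i"
  fix x\<^sub>0 and e :: real assume x0: "x\<^sub>0 \<in> S" and "e > 0"
  \<comment> \<open>Two tails contribute \<open>\<eta> * B\<close> each, the finite part contributes \<open>\<eta>\<close>.\<close>
  define \<eta> where "\<eta> = e / (1 + 2 * B)"
  have \<eta>: "\<eta> > 0" "\<eta> * (1 + 2 * B) = e"
    using \<open>e > 0\<close> \<open>0 \<le> B\<close> by (auto simp: \<eta>_def)
  obtain F where F: "finite F" "F \<subseteq> A" and F1: "dist (\<Sum>i\<in>F. w i x\<^sub>0) 1 < \<eta>"
    using tendstoD[OF unity[OF x0, unfolded has_sum_def] \<eta>(1)]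
    by (auto simp: eventually_finite_subsets_at_top)
  have tail: "dist (?h x) (\<Sum>i\<in>F. w i x *\<^sub>R v i) \<le> \<eta> * B"
    if x: "x \<in> S" "(\<Sum>i\<in>F. w i x) > 1 - \<eta>" for x
  proof -
    have rest: "((\<lambda>i. w i x) has_sum (1 - (\<Sum>i\<in>F. w i x))) (A - F)"
      using F x by (intro has_sum_Diff unity has_sum_finite)
    have "?h x - (\<Sum>i\<in>F. w i x *\<^sub>R v i) = (\<Sum>\<^sub>\<infinity>i\<in>A - F. w i x *\<^sub>R v i)"
      using F weighted_family_summable(1)[OF unity[OF x(1)] nonneg bound]
      by (subst infsum_Diff) auto
    moreover have "norm \<dots> \<le> (1 - (\<Sum>i\<in>F. w i x)) * B"
      by (rule weighted_family_summable(2)[OF rest]) (auto intro: nonneg bound)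
    moreover have "\<dots> \<le> \<eta> * B"
      using x \<open>0 \<le> B\<close> by (intro mult_right_mono) auto
    ultimately show ?thesis by (simp add: dist_norm)
  qed
  have lim: "((\<lambda>x. \<Sum>i\<in>F. w i x) \<longlongrightarrow> (\<Sum>i\<in>F. w i x\<^sub>0)) (at x\<^sub>0 within S)"
    "((\<lambda>x. \<Sum>i\<in>F. w i x *\<^sub>R v i) \<longlongrightarrow> (\<Sum>i\<in>F. w i x\<^sub>0 *\<^sub>R v i)) (at x\<^sub>0 within S)"
    using cont F x0 by (auto intro!: tendsto_intros simp: continuous_on_def)
  have F0: "(\<Sum>i\<in>F. w i x\<^sub>0) > 1 - \<eta>"
    using F1 by (simp add: dist_real_def abs_less_iff)
  have near: "\<forall>\<^sub>F x in at x\<^sub>0 within S. (\<Sum>i\<in>F. w i x) > 1 - \<eta>"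
    using order_tendstoD(1)[OF lim(1) F0] .
  have "\<forall>\<^sub>F x in at x\<^sub>0 within S. x \<in> S"
    by (simp add: eventually_at_filter)
  with near tendstoD[OF lim(2) \<eta>(1)]
  show "\<forall>\<^sub>F x in at x\<^sub>0 within S. dist (?h x) (?h x\<^sub>0) < e"
  proof eventually_elim
    case (elim x)
    have "dist (?h x) (?h x\<^sub>0) < \<eta> * B + \<eta> + \<eta> * B"
      using tail[OF elim(3,1)] tail[OF x0 F0] elim(2)
        dist_triangle[of "?h x" "?h x\<^sub>0" "\<Sum>i\<in>F. w i x *\<^sub>R v i"]
        dist_triangle[of "\<Sum>i\<in>F. w i x *\<^sub>R v i" "?h x\<^sub>0" "\<Sum>i\<in>F. w i x\<^sub>0 *\<^sub>R v i"]
        dist_commute[of "\<Sum>i\<in>F. w i x\<^sub>0 *\<^sub>R v i" "?h x\<^sub>0"]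
      by linarith
    then show ?case using \<eta>(2) by (simp add: algebra_simps)
  qed
qed

text \<open>
  Sublinearity is what continuous seminorms, real-linear functionals and the norm itself have in
  common, and all that the bounds below require of them.
\<close>

definition sublinear :: "('a::real_vector \<Rightarrow> real) \<Rightarrow> bool" where
  "sublinear p \<longleftrightarrow> pos_homogeneous p \<and> (\<forall>x y. p (x + y) \<le> p x + p y)"

lemma sublinear_norm: "sublinear (norm :: 'a::real_normed_vector \<Rightarrow> real)"
  by (simp add: sublinear_def pos_homogeneous_def norm_triangle_ineq)

lemma sublinear_sum:
  assumes "sublinear p" "finite F"
  shows "p (sum v F) \<le> (\<Sum>i\<in>F. p (v i))"
  using assms(2)
proof (induction rule: finite_induct)
  case empty
  have "p (0 *\<^sub>R 0) = 0 *\<^sub>R p 0"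
    using assms(1) unfolding sublinear_def pos_homogeneous_def by blast
  then show ?case by simp
next
  case (insert i F)
  have "p (v i + sum v F) \<le> p (v i) + p (sum v F)"
    using assms(1) by (simp add: sublinear_def)
  then show ?case using insert by simp
qed

text \<open>
  A version of Jensen's inequality for infinite convex combinations. Only the vectors of positive
  weight matter, so that for the weights of a partition of unity a bound near the evaluation point
  suffices. Subadditivity settles the finite partial sums, and continuity of \<open>p\<close> carries the bound
  over to the limit.
\<close>

lemma sublinear_convex_combination_le:
  fixes v :: "'i \<Rightarrow> 'b::real_normed_vector"
  assumes p: "sublinear p" "continuous_on UNIV p"
    and w: "(w has_sum 1) A" "\<And>i. i \<in> A \<Longrightarrow> 0 \<le> w i"
    and y: "((\<lambda>i. w i *\<^sub>R v i) has_sum y) A"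
    and le: "\<And>i. i \<in> A \<Longrightarrow> 0 < w i \<Longrightarrow> p (v i) \<le> \<alpha>"
  shows "p y \<le> \<alpha>"
proof -
  have partial: "p (\<Sum>i\<in>F. w i *\<^sub>R v i) \<le> (\<Sum>i\<in>F. w i) * \<alpha>" if F: "finite F" "F \<subseteq> A" for F
  proof -
    have "p (\<Sum>i\<in>F. w i *\<^sub>R v i) \<le> (\<Sum>i\<in>F. p (w i *\<^sub>R v i))"
      using p(1) F(1) by (rule sublinear_sum)
    also have "\<dots> = (\<Sum>i\<in>F. w i * p (v i))"
      using p(1) w(2) F by (intro sum.cong) (auto simp: sublinear_def pos_homogeneous_def)
    also have "\<dots> \<le> (\<Sum>i\<in>F. w i * \<alpha>)"
    proof (rule sum_mono)
      fix i assume "i \<in> F"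
      then show "w i * p (v i) \<le> w i * \<alpha>"
        using le[of i] w(2)[of i] F by (cases "w i = 0") (auto intro: mult_left_mono)
    qed
    finally show ?thesis by (simp add: sum_distrib_right)
  qed
  have "((\<lambda>F. (\<Sum>i\<in>F. w i) * \<alpha>) \<longlongrightarrow> 1 * \<alpha>) (finite_subsets_at_top A)"
    using w(1) unfolding has_sum_def by (rule tendsto_mult_right)
  moreover have "((\<lambda>F. p (\<Sum>i\<in>F. w i *\<^sub>R v i)) \<longlongrightarrow> p y) (finite_subsets_at_top A)"
    using y by (intro continuous_on_tendsto_compose[OF p(2)]) (auto simp: has_sum_def)
  ultimately have "p y \<le> 1 * \<alpha>"
    by (rule tendsto_le[OF finite_subsets_at_top_neq_bot])
      (intro eventually_finite_subsets_at_top_weakI partial)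
  then show ?thesis by simp
qed

lemma additive_cone_has_sum:
  fixes v :: "'i \<Rightarrow> 'b::real_normed_vector"
  assumes D: "closed D" "additive_cone D" "0 \<in> D"
    and y: "(v has_sum y) A" and v: "\<And>i. i \<in> A \<Longrightarrow> v i \<in> D"
  shows "y \<in> D"
proof (rule Lim_in_closed_set[OF D(1) _ finite_subsets_at_top_neq_bot])
  have "sum v F \<in> D" if "finite F" "F \<subseteq> A" for F
    using that D v by (induction rule: finite_induct) (auto simp: additive_cone_def)
  then show "\<forall>\<^sub>F F in finite_subsets_at_top A. sum v F \<in> D"
    by (rule eventually_finite_subsets_at_top_weakI)
  show "(sum v \<longlongrightarrow> y) (finite_subsets_at_top A)"
    using y by (simp add: has_sum_def)
qed

section \<open>Positively homogeneous extension\<close>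

text \<open>
  Away from 0 the extension is continuous because \<open>sgn\<close> is; at 0, where \<open>sgn 0 = 0\<close> makes the
  value of \<open>h\<close> arbitrary, the factor \<open>norm x\<close> and the bound on the sphere force the limit 0.
\<close>

lemma pos_homogeneous_extension:
  fixes h :: "'a::real_normed_vector \<Rightarrow> 'b::real_normed_vector"
  assumes cont: "continuous_on (sphere 0 1) h"
    and bound: "\<And>s. norm s = 1 \<Longrightarrow> norm (h s) \<le> L"
  shows "continuous_on UNIV (\<lambda>x. norm x *\<^sub>R h (sgn x))"
    and "pos_homogeneous (\<lambda>x. norm x *\<^sub>R h (sgn x))"
proof -
  let ?f = "\<lambda>x. norm x *\<^sub>R h (sgn x)"
  have "isCont ?f x" for x
  proof (cases "x = 0")
    case True
    have "norm (?f y) \<le> norm y * L" for y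
      using bound[of "sgn y"] by (cases "y = 0") (simp_all add: norm_sgn mult_left_mono)
    then have "\<forall>\<^sub>F y in at 0. norm (?f y) \<le> norm y * L"
      by (intro always_eventually) simp
    moreover have "((\<lambda>y::'a. norm y * L) \<longlongrightarrow> 0) (at 0)"
      by (auto intro!: tendsto_eq_intros)
    ultimately have "(?f \<longlongrightarrow> 0) (at 0)"
      by (rule Lim_null_comparison)
    then show ?thesis using True by (simp add: isCont_def)
  next
    case False
    have "continuous_on (- {0}) (\<lambda>y. h (sgn y))"
      by (rule continuous_on_compose2[OF cont])
        (auto intro!: continuous_intros simp: norm_sgn split: if_splits)
    then have "continuous_on (- {0}) ?f"
      by (intro continuous_intros)
    then show ?thesis
      using False by (simp add: continuous_on_eq_continuous_at open_Compl)
  qed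
  then show "continuous_on UNIV ?f" by (simp add: continuous_on_eq_continuous_at)
  show "pos_homogeneous ?f"
    unfolding pos_homogeneous_def
  proof (intro allI impI)
    fix c :: real and x :: 'a assume "c \<ge> 0"
    then show "?f (c *\<^sub>R x) = c *\<^sub>R ?f x"
      by (cases "c = 0") (auto simp: sgn_scaleR)
  qed
qed

section \<open>Correcting an approximate right inverse\<close>

text \<open>
  Let \<open>r x = x - T (f\<^sub>0 x)\<close> be the error that \<open>f\<^sub>0\<close> leaves. It shrinks norms by the factor \<open>\<theta>\<close>, so
  \<open>f x = f\<^sub>0 x + f\<^sub>0 (r x) + f\<^sub>0 (r (r x)) + \<dots>\<close> converges locally uniformly and \<open>T (f x)\<close> telescopes
  to \<open>x\<close>. Only nonnegative combinations of values of \<open>f\<^sub>0\<close> occur, which is why \<open>f\<close> stays in the cone.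
  The recursive equation in the conclusion serves to compare \<open>f\<close> with \<open>f\<^sub>0\<close>: the difference is the
  value of \<open>f\<close> at the small vector \<open>r x\<close>.
\<close>

lemma correct_approximate_right_inverse:
  fixes T :: "'b::banach \<Rightarrow> 'a::real_normed_vector"
  assumes T: "bounded_linear T"
    and D: "closed D" "additive_cone D" "0 \<in> D"
    and f0: "continuous_on UNIV f\<^sub>0" "pos_homogeneous f\<^sub>0" "\<And>x. f\<^sub>0 x \<in> D"
    and L: "\<And>x. norm (f\<^sub>0 x) \<le> L * norm x" "0 \<le> L"
    and \<theta>: "\<And>x. norm (T (f\<^sub>0 x) - x) \<le> \<theta> * norm x" "0 \<le> \<theta>" "\<theta> < 1"
  obtains f where "continuous_on UNIV f" "pos_homogeneous f" "\<And>x. f x \<in> D" "\<And>x. T (f x) = x"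
    and "\<And>x. norm (f x) \<le> L / (1 - \<theta>) * norm x"
    and "\<And>x. f x = f\<^sub>0 x + f (x - T (f\<^sub>0 x))"
proof -
  interpret T: bounded_linear T by (rule T)
  define r where "r x = x - T (f\<^sub>0 x)" for x
  define f where "f x = (\<Sum>n. f\<^sub>0 ((r ^^ n) x))" for x
  have r_cont: "continuous_on UNIV (r ^^ n)" for n
  proof (induction n)
    case (Suc n)
    have "continuous_on UNIV r"
      unfolding r_def by (intro continuous_intros T.continuous_on f0)
    then show ?case
      using Suc by (auto intro!: continuous_on_compose2[of UNIV r UNIV "r ^^ n"])
  qed simp
  have r_hom: "(r ^^ n) (c *\<^sub>R x) = c *\<^sub>R (r ^^ n) x" if "c \<ge> 0" for n c x
    using that f0(2)
    by (induction n) (auto simp: r_def pos_homogeneous_def T.scaleR algebra_simps)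
  have r_norm: "norm ((r ^^ n) x) \<le> \<theta> ^ n * norm x" for n x
  proof (induction n)
    case (Suc n)
    have "norm ((r ^^ Suc n) x) \<le> \<theta> * norm ((r ^^ n) x)"
      using \<theta>(1)[of "(r ^^ n) x"] by (simp add: r_def norm_minus_commute)
    also have "\<dots> \<le> \<theta> * (\<theta> ^ n * norm x)"
      using Suc \<theta>(2) by (intro mult_left_mono)
    finally show ?case by (simp add: mult_ac)
  qed simp
  have term_le: "norm (f\<^sub>0 ((r ^^ n) x)) \<le> L * norm x * \<theta> ^ n" for n x
  proof -
    have "norm (f\<^sub>0 ((r ^^ n) x)) \<le> L * norm ((r ^^ n) x)" by (rule L)
    also have "\<dots> \<le> L * (\<theta> ^ n * norm x)" using r_norm L(2) by (rule mult_left_mono)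
    finally show ?thesis by (simp add: mult_ac)
  qed
  have geom: "(\<lambda>n. K * \<theta> ^ n) sums (K / (1 - \<theta>))" for K
    using sums_mult[OF geometric_sums[of \<theta>], of K] \<theta> by simp
  have summ_norm: "summable (\<lambda>n. norm (f\<^sub>0 ((r ^^ n) x)))" for x
    by (rule summable_comparison_test[OF _ sums_summable[OF geom[of "L * norm x"]]]) (use term_le in auto)
  note summ = summable_norm_cancel[OF summ_norm]
  have f_cont: "continuous_on UNIV f"
  proof -
    have "isCont f x" for x
    proof -
      have "continuous_on (ball 0 (norm x + 1)) f"
      proof (rule uniform_limit_theorem)
        show "uniform_limit (ball 0 (norm x + 1)) (\<lambda>n y. \<Sum>i<n. f\<^sub>0 ((r ^^ i) y)) f sequentially"
          unfolding f_def
        proof (rule Weierstrass_m_test)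
          fix n and y assume "y \<in> ball (0::'a) (norm x + 1)"
          then have "L * norm y * \<theta> ^ n \<le> L * (norm x + 1) * \<theta> ^ n"
            using L(2) \<theta>(2) by (intro mult_right_mono mult_left_mono) auto
          then show "norm (f\<^sub>0 ((r ^^ n) y)) \<le> L * (norm x + 1) * \<theta> ^ n"
            using term_le[of n y] by linarith
        qed (rule sums_summable[OF geom])
        show "\<forall>\<^sub>F n in sequentially. continuous_on (ball 0 (norm x + 1)) (\<lambda>y. \<Sum>i<n. f\<^sub>0 ((r ^^ i) y))"
          by (intro always_eventually allI continuous_on_sum continuous_on_compose2[OF f0(1)]
              continuous_on_subset[OF r_cont]) auto
      qed simp
      then show ?thesis
        by (simp add: continuous_on_eq_continuous_at)
    qed
    then show ?thesis by (simp add: continuous_on_eq_continuous_at)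
  qed
  show thesis
  proof (rule that[OF f_cont])
    show "pos_homogeneous f"
      using f0(2) summ by (auto simp: pos_homogeneous_def f_def r_hom intro!: suminf_scaleR_right[symmetric])
    show "f x \<in> D" for x
    proof (rule additive_cone_has_sum[OF D])
      show "((\<lambda>n. f\<^sub>0 ((r ^^ n) x)) has_sum f x) UNIV"
        unfolding f_def by (intro norm_summable_imp_has_sum summ_norm summable_sums summ)
    qed (rule f0)
    show "T (f x) = x" for x
    proof -
      have "(\<lambda>n. T (f\<^sub>0 ((r ^^ n) x))) sums T (f x)"
        unfolding f_def by (intro T.sums summable_sums summ)
      moreover have "(\<lambda>n. (r ^^ n) x - (r ^^ Suc n) x) sums ((r ^^ 0) x - 0)"
      proof (rule telescope_sums')
        have "(\<lambda>n. \<theta> ^ n * norm x) \<longlonglongrightarrow> 0 * norm x"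
          using \<theta> by (intro tendsto_mult_right[OF LIMSEQ_power_zero]) simp
        then show "(\<lambda>n. (r ^^ n) x) \<longlonglongrightarrow> 0"
          by (intro Lim_null_comparison[of "\<lambda>n. (r ^^ n) x" "\<lambda>n. \<theta> ^ n * norm x"])
            (simp_all add: r_norm)
      qed
      moreover have "(r ^^ n) x - (r ^^ Suc n) x = T (f\<^sub>0 ((r ^^ n) x))" for n
        by (simp add: r_def)
      ultimately show ?thesis by (simp add: sums_unique2)
    qed
    show "norm (f x) \<le> L / (1 - \<theta>) * norm x" for x
    proof -
      have "norm (f x) \<le> (\<Sum>n. norm (f\<^sub>0 ((r ^^ n) x)))"
        unfolding f_def by (rule summable_norm[OF summ_norm])
      also have "\<dots> \<le> (\<Sum>n. L * norm x * \<theta> ^ n)"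
        by (intro suminf_le term_le summ_norm sums_summable[OF geom])
      also have "\<dots> = L * norm x / (1 - \<theta>)"
        by (rule sums_unique[OF geom, symmetric])
      finally show ?thesis by simp
    qed
    show "f x = f\<^sub>0 x + f (x - T (f\<^sub>0 x))" for x
      using suminf_split_head[OF summ[of x]]
      by (simp add: f_def funpow_Suc_right r_def[of x, symmetric] del: funpow.simps(2))
  qed
qed

section \<open>Continuous right inverses with values in a cone\<close>

text \<open>
  The passage from an arbitrary, discontinuous choice \<open>g\<close> of approximate preimages on the unit
  sphere to a continuous right inverse. Averaging \<open>g\<close> with a partition of unity of mesh \<open>\<delta>\<close>
  gives a continuous map which inherits every sublinear bound and membership in the cone, and whose
  approximation error grows from \<open>\<eta>\<close> to at most \<open>\<eta> + \<delta>\<close>. Its positively homogeneous extension is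
  then corrected to an exact right inverse; the correction costs a factor \<open>1 / (1 - (\<eta> + \<delta>))\<close> in
  norm and adds to each \<open>p j\<close> at most \<open>M\<close> times the norm of \<open>f\<close> at the error vector. For \<open>\<eta> = 0\<close>
  both losses vanish as \<open>\<delta>\<close> tends to 0.
\<close>

lemma continuous_right_inverse_in_cone:
  fixes T :: "'b::banach \<Rightarrow> 'a::real_normed_vector"
    and p :: "'j \<Rightarrow> 'b \<Rightarrow> real"
  assumes T: "bounded_linear T"
    and D: "closed D" "additive_cone D" "0 \<in> D"
    and g: "\<And>s. norm s = 1 \<Longrightarrow> g s \<in> D"
      "\<And>s. norm s = 1 \<Longrightarrow> norm (g s) \<le> L"
      "\<And>s. norm s = 1 \<Longrightarrow> norm (T (g s) - s) \<le> \<eta>"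
    and L: "0 \<le> L" and \<delta>: "0 \<le> \<eta>" "0 < \<delta>" "\<eta> + \<delta> < 1"
    and p: "\<And>j. j \<in> J \<Longrightarrow> sublinear (p j)" "\<And>j. j \<in> J \<Longrightarrow> continuous_on UNIV (p j)"
      "\<And>j y. j \<in> J \<Longrightarrow> p j y \<le> M * norm y" "0 \<le> M"
      "\<And>j s. j \<in> J \<Longrightarrow> norm s = 1 \<Longrightarrow> p j (g s) \<le> \<alpha> j"
  obtains f where "continuous_on UNIV f" "pos_homogeneous f" "\<And>x. f x \<in> D" "\<And>x. T (f x) = x"
    and "\<And>x. norm (f x) \<le> L / (1 - (\<eta> + \<delta>)) * norm x"
    and "\<And>j x. j \<in> J \<Longrightarrow> p j (f x) \<le> (\<alpha> j + M * L * (\<eta> + \<delta>) / (1 - (\<eta> + \<delta>))) * norm x"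
proof -
  interpret T: bounded_linear T by (rule T)
  obtain w :: "'a \<Rightarrow> 'a \<Rightarrow> real"
    where w: "\<And>s x. 0 \<le> w s x" "\<And>s x. w s x > 0 \<Longrightarrow> dist x s < \<delta>"
      "\<And>s U. continuous_on U (w s)"
      "\<And>x. x \<in> sphere 0 1 \<Longrightarrow> ((\<lambda>s. w s x) has_sum 1) (sphere 0 1)"
    using partition_of_unity_by_balls[OF \<open>0 < \<delta>\<close>, of "sphere 0 1"] by metis
  define h where "h x = (\<Sum>\<^sub>\<infinity>s\<in>sphere 0 1. w s x *\<^sub>R g s)" for x
  have g_le: "s \<in> sphere 0 1 \<Longrightarrow> norm (g s) \<le> L" for s using g(2) by simp
  have h_cont: "continuous_on (sphere 0 1) h"
    unfolding h_def by (rule continuous_on_convex_combination[OF w(3,1,4) g_le L])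
  have h: "((\<lambda>s. w s x *\<^sub>R g s) has_sum h x) (sphere 0 1)" if "norm x = 1" for x
    unfolding h_def using that
    by (intro has_sum_infsum weighted_family_summable(1)[OF w(4,1) g_le]) auto
  have h_p: "p (h x) \<le> \<alpha>"
    if "sublinear p" "continuous_on UNIV p" "\<And>s. norm s = 1 \<Longrightarrow> p (g s) \<le> \<alpha>" "norm x = 1" for p \<alpha> x
    by (rule sublinear_convex_combination_le[OF that(1,2) w(4,1) h]) (use that in auto)
  have h_L: "norm (h x) \<le> L" if "norm x = 1" for x
    using h_p[OF sublinear_norm continuous_on_norm_id g(2) that] by simp
  have h_D: "h x \<in> D" if "norm x = 1" for x
    using D(2) g(1) w(1) by (intro additive_cone_has_sum[OF D h[OF that]]) (auto simp: additive_cone_def cone_def)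
  have h_T: "norm (T (h x) - x) \<le> \<eta> + \<delta>" if "norm x = 1" for x
  proof (rule sublinear_convex_combination_le[OF sublinear_norm continuous_on_norm_id w(4,1)])
    show "x \<in> sphere 0 1" using that by simp
    \<comment> \<open>As the weights add up to 1, the error at \<open>x\<close> is the average of the vectors \<open>T (g s) - x\<close>.\<close>
    have "((\<lambda>s. w s x *\<^sub>R T (g s) + w s x *\<^sub>R (- x)) has_sum (T (h x) + 1 *\<^sub>R (- x))) (sphere 0 1)"
    proof (intro has_sum_add)
      show "((\<lambda>s. w s x *\<^sub>R T (g s)) has_sum T (h x)) (sphere 0 1)"
        using has_sum_bounded_linear[OF T h[OF that]] by (simp add: T.scaleR)
      show "((\<lambda>s. w s x *\<^sub>R (- x)) has_sum 1 *\<^sub>R (- x)) (sphere 0 1)"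
        using that by (intro has_sum_bounded_linear[OF bounded_linear_scaleR_left] w(4)) auto
    qed
    then show "((\<lambda>s. w s x *\<^sub>R (T (g s) - x)) has_sum (T (h x) - x)) (sphere 0 1)"
      by (simp add: scaleR_diff_right)
    fix s :: 'a assume s: "s \<in> sphere 0 1" "0 < w s x"
    have "norm (T (g s) - x) \<le> norm (T (g s) - s) + norm (s - x)"
      using norm_triangle_ineq[of "T (g s) - s" "s - x"] by simp
    then show "norm (T (g s) - x) \<le> \<eta> + \<delta>"
      using g(3)[of s] w(2)[OF s(2)] s(1) by (simp add: dist_norm norm_minus_commute)
  qed
  define f\<^sub>0 where "f\<^sub>0 x = norm x *\<^sub>R h (sgn x)" for x
  have sgn_1: "norm (sgn x) = 1" if "x \<noteq> 0" for x :: 'a using that by (simp add: norm_sgn)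
  have norm_sgn_eq: "norm x *\<^sub>R sgn x = x" for x :: 'a by (cases "x = 0") (simp_all add: sgn_div_norm)
  have f0: "continuous_on UNIV f\<^sub>0" "pos_homogeneous f\<^sub>0"
    unfolding f\<^sub>0_def by (rule pos_homogeneous_extension[OF h_cont h_L]; assumption)+
  have f0_D: "f\<^sub>0 x \<in> D" for x
    using D h_D[OF sgn_1] by (cases "x = 0") (auto simp: f\<^sub>0_def additive_cone_def cone_def)
  have f0_p: "p (f\<^sub>0 x) \<le> \<alpha> * norm x"
    if "sublinear p" "continuous_on UNIV p" "\<And>s. norm s = 1 \<Longrightarrow> p (g s) \<le> \<alpha>" for p \<alpha> x
  proof -
    have eq: "p (f\<^sub>0 x) = norm x * p (h (sgn x))"
      using that(1) by (simp add: sublinear_def pos_homogeneous_def f\<^sub>0_def)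
    show ?thesis
    proof (cases "x = 0")
      case False
      then show ?thesis
        unfolding eq using h_p[OF that sgn_1[OF False]] by (simp add: mult.commute[of _ "norm x"] mult_left_mono)
    qed (use eq in simp)
  qed
  have f0_T: "norm (T (f\<^sub>0 x) - x) \<le> (\<eta> + \<delta>) * norm x" for x
  proof (cases "x = 0")
    case False
    have "T (f\<^sub>0 x) - x = norm x *\<^sub>R (T (h (sgn x)) - sgn x)"
      by (simp add: f\<^sub>0_def T.scaleR scaleR_diff_right norm_sgn_eq)
    then show ?thesis using h_T[OF sgn_1[OF False]] by (simp add: mult.commute[of _ "norm x"] mult_left_mono)
  qed (simp add: f\<^sub>0_def)
  have f0_L: "norm (f\<^sub>0 x) \<le> L * norm x" for x
    by (rule f0_p[OF sublinear_norm continuous_on_norm_id g(2)])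
  have \<theta>: "0 \<le> \<eta> + \<delta>" "\<eta> + \<delta> < 1" using \<delta> by auto
  obtain f where f: "continuous_on UNIV f" "pos_homogeneous f" "\<And>x. f x \<in> D" "\<And>x. T (f x) = x"
    and f_norm: "\<And>x. norm (f x) \<le> L / (1 - (\<eta> + \<delta>)) * norm x"
    and f_rec: "\<And>x. f x = f\<^sub>0 x + f (x - T (f\<^sub>0 x))"
    using correct_approximate_right_inverse[OF T D f0 f0_D f0_L L f0_T \<theta>] by blast
  show thesis
  proof (rule that[OF f f_norm])
    fix j x assume j: "j \<in> J"
    have "p j (f x) \<le> p j (f\<^sub>0 x) + p j (f (x - T (f\<^sub>0 x)))"
      using p(1)[OF j] by (subst f_rec) (simp add: sublinear_def)
    also have "\<dots> \<le> \<alpha> j * norm x + M * (L / (1 - (\<eta> + \<delta>)) * ((\<eta> + \<delta>) * norm x))"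
    proof (rule add_mono[OF f0_p[OF p(1,2,5)] order_trans[OF p(3) mult_left_mono[OF _ p(4)]], OF j j j _ j])
      have "norm (f (x - T (f\<^sub>0 x))) \<le> L / (1 - (\<eta> + \<delta>)) * norm (x - T (f\<^sub>0 x))"
        by (rule f_norm)
      also have "\<dots> \<le> L / (1 - (\<eta> + \<delta>)) * ((\<eta> + \<delta>) * norm x)"
        using f0_T[of x] L \<delta> by (intro mult_left_mono) (auto simp: norm_minus_commute)
      finally show "norm (f (x - T (f\<^sub>0 x))) \<le> \<dots>" .
    qed
    finally show "p j (f x) \<le> (\<alpha> j + M * L * (\<eta> + \<delta>) / (1 - (\<eta> + \<delta>))) * norm x"
      by (simp only: distrib_right times_divide_eq_left times_divide_eq_right mult.assoc)
  qed
qed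

section \<open>Approximate openness of a surjection on a cone\<close>

text \<open>
  This is the Baire category half of the open mapping theorem. The closures of the images of the
  bounded parts of the cone \<open>D\<close> cover the complete space, so one of them contains a ball around some
  \<open>x\<^sub>0\<close>. A cone has no symmetry to recentre that ball at 0; instead, a preimage in \<open>D\<close> of \<open>- x\<^sub>0\<close>
  is added. The other half, from approximate to exact preimages, is left to the continuous
  correction procedure above.
\<close>

lemma surjective_on_cone_approximate_preimages:
  fixes T :: "'b::real_normed_vector \<Rightarrow> 'a::banach"
  assumes T: "bounded_linear T" and D: "additive_cone D" and surj: "T ` D = UNIV"
  obtains L where "0 < L"
    and "\<And>s. norm s = 1 \<Longrightarrow> \<exists>c\<in>D. norm c \<le> L \<and> norm (T c - s) \<le> 1 / 2"
proof -
  interpret T: bounded_linear T by (rule T)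
  define A where "A n = closure (T ` (D \<inter> cball 0 (real n)))" for n
  have "\<exists>n. interior (A n) \<noteq> {}"
  proof (rule ccontr)
    assume "\<nexists>n. interior (A n) \<noteq> {}"
    then have "euclidean interior_of \<Union>(range A) = {}"
      by (intro Baire_category_alt disjI1 completely_metrizable_space_euclidean)
        (auto simp: A_def)
    moreover have "\<Union>(range A) = UNIV"
    proof (intro equalityI subsetI UNIV_I)
      fix x :: 'a
      obtain c where c: "c \<in> D" "x = T c" using surj by (metis UNIV_I imageE)
      obtain n where "norm c \<le> real n" using real_arch_simple by blast
      then have "x \<in> A n" using c closure_subset unfolding A_def by fastforce
      then show "x \<in> \<Union>(range A)" by blast
    qed
    ultimately show False by simp
  qed
  then obtain n x\<^sub>0 r where r: "r > 0" "ball x\<^sub>0 r \<subseteq> A n"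
    by (metis equals0I mem_interior)
  obtain c\<^sub>0 where c0: "c\<^sub>0 \<in> D" "T c\<^sub>0 = - x\<^sub>0" using surj by (metis UNIV_I imageE)
  define L where "L = 2 / r * (real n + norm c\<^sub>0) + 1"
  show thesis
  proof (rule that)
    show "0 < L" using r by (auto simp: L_def intro!: add_nonneg_pos)
    fix s :: 'a assume s: "norm s = 1"
    have "x\<^sub>0 + (r / 2) *\<^sub>R s \<in> A n"
      using s r(1) by (intro subsetD[OF r(2)]) (simp add: dist_norm)
    then obtain c where c: "c \<in> D" "norm c \<le> real n" "dist (T c) (x\<^sub>0 + (r / 2) *\<^sub>R s) < r / 4"
      using r(1) unfolding A_def closure_approachable by (auto dest!: spec[of _ "r / 4"])
    \<comment> \<open>\<open>T (c + c\<^sub>0)\<close> is within \<open>r / 4\<close> of \<open>(r / 2) *\<^sub>R s\<close>; rescaling turns the error into 1/2.\<close>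
    let ?c = "(2 / r) *\<^sub>R (c + c\<^sub>0)"
    show "\<exists>c\<in>D. norm c \<le> L \<and> norm (T c - s) \<le> 1 / 2"
    proof (intro bexI[of _ ?c] conjI)
      show "?c \<in> D" using D c(1) c0(1) r(1) by (auto simp: additive_cone_def cone_def)
      have "norm ?c \<le> 2 / r * (real n + norm c\<^sub>0)"
        using norm_triangle_ineq[of c c\<^sub>0] c(2) r(1) by (auto intro!: divide_right_mono)
      then show "norm ?c \<le> L" by (simp add: L_def)
      have "T ?c - s = (2 / r) *\<^sub>R (T c - (x\<^sub>0 + (r / 2) *\<^sub>R s))"
        using r(1) by (simp add: T.scaleR T.add c0(2) algebra_simps)
      then have "norm (T ?c - s) = 2 / r * dist (T c) (x\<^sub>0 + (r / 2) *\<^sub>R s)"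
        using r(1) by (simp add: dist_norm)
      also have "\<dots> \<le> 2 / r * (r / 4)"
        using c(3) r(1) by (intro mult_left_mono) auto
      finally show "norm (T ?c - s) \<le> 1 / 2" using r(1) by simp
    qed
  qed
qed

section \<open>Summation on the direct sum\<close>

definition ell1_sum :: "('i, 'a::banach) ell1 \<Rightarrow> 'a" where
  "ell1_sum y = (\<Sum>\<^sub>\<infinity>i. ell1_nth y i)"

lemma ell1_nth_summable: "ell1_nth (y :: ('i, 'a::banach) ell1) summable_on UNIV"
  using ell1_summable by (rule abs_summable_summable)

lemma has_sum_ell1_nth_iff: "(ell1_nth y has_sum x) UNIV \<longleftrightarrow> ell1_sum y = x"
  unfolding ell1_sum_def by (metis ell1_nth_summable has_sum_infsum infsumI)

lemma bounded_linear_ell1_sum: "bounded_linear (ell1_sum :: ('i, 'a::banach) ell1 \<Rightarrow> 'a)"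
proof (rule bounded_linear_intro[of _ 1])
  fix x y :: "('i, 'a) ell1" and c :: real
  show "ell1_sum (x + y) = ell1_sum x + ell1_sum y"
    unfolding ell1_sum_def ell1_nth_ops by (intro infsum_add ell1_nth_summable)
  show "ell1_sum (c *\<^sub>R x) = c *\<^sub>R ell1_sum x"
    unfolding ell1_sum_def ell1_nth_ops by (rule infsum_scaleR_right)
  show "norm (ell1_sum x) \<le> norm x * 1"
    unfolding ell1_sum_def norm_ell1_def using norm_infsum_bound[OF ell1_summable] by simp
qed

lemma bounded_linear_ell1_nth: "bounded_linear (\<lambda>y. ell1_nth y i)"
  by (rule bounded_linear_intro[of _ 1]) (simp_all add: ell1_nth_ops norm_ell1_nth_le)

lemma pos_homogeneous_ell1_nth:
  "pos_homogeneous \<gamma> \<Longrightarrow> pos_homogeneous (\<lambda>x. ell1_nth (\<gamma> x) i)"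
  by (simp add: pos_homogeneous_def ell1_nth_ops)

lemma closed_ell1_cone:
  assumes "\<And>i. closed (C i)"
  shows "closed (ell1_cone C)"
proof -
  have "ell1_cone C = (\<Inter>i. (\<lambda>y. ell1_nth y i) -` C i)"
    by (auto simp: ell1_cone_def)
  moreover have "closed ((\<lambda>y. ell1_nth y i) -` C i)" for i
    by (intro closed_vimage assms linear_continuous_on bounded_linear_ell1_nth)
  ultimately show ?thesis by (simp add: closed_INT)
qed

lemma additive_cone_ell1_cone: "(\<And>i. additive_cone (C i)) \<Longrightarrow> additive_cone (ell1_cone C)"
  by (auto simp: additive_cone_def cone_def ell1_cone_def ell1_nth_ops)

section \<open>Seminorms and functionals\<close>

lemma sublinear_seminorm_or_linear:
  assumes "is_seminorm p \<or> linear p"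
  shows "sublinear p"
  using assms
  by (auto simp: sublinear_def pos_homogeneous_def is_seminorm_def linear_add linear_scale)

text \<open>
  A quantitative bound is needed because the correction of an approximate right inverse perturbs the
  values of the functionals by a multiple of the norm.
\<close>

lemma continuous_sublinear_bounded:
  fixes p :: "'a::real_normed_vector \<Rightarrow> real"
  assumes p: "sublinear p" "continuous_on UNIV p"
  obtains M where "0 \<le> M" "\<And>y. p y \<le> M * norm y"
proof -
  have hom: "p (c *\<^sub>R y) = c * p y" if "c \<ge> 0" for c y
    using p(1) that by (simp add: sublinear_def pos_homogeneous_def)
  have p0: "p 0 = 0" using hom[of 0 0] by simp
  have "isCont p 0" using p(2) by (simp add: continuous_on_eq_continuous_at)
  then obtain d where d: "d > 0" "\<And>y. norm y < d \<Longrightarrow> \<bar>p y\<bar> < 1"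
    unfolding continuous_at_eps_delta using p0 by (auto simp: dist_real_def dest!: spec[of _ 1])
  show thesis
  proof (rule that[of "2 / d"])
    fix y
    show "p y \<le> 2 / d * norm y"
    proof (cases "y = 0")
      case False
      let ?c = "d / (2 * norm y)"
      have "?c * p y = p (?c *\<^sub>R y)" using d by (simp add: hom)
      also have "\<dots> \<le> 1" using d(2)[of "?c *\<^sub>R y"] d(1) False by simp
      finally show ?thesis using d(1) False by (simp add: field_simps)
    qed (simp add: p0)
  qed (use d in simp)
qed

section \<open>Continuous decompositions\<close>

theorem theorem4p1:
  fixes C :: "'i \<Rightarrow> 'a::banach set"
    and J :: "'j set"
    and \<rho> :: "'j \<Rightarrow> ('i, 'a) ell1 \<Rightarrow> real"
  assumes closed_C: "\<And>i. closed (C i)"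
    and cone_C: "\<And>i. additive_cone (C i)"
    and decomposition: "\<And>x. \<exists>c. (\<forall>i. c i \<in> C i) \<and> (\<lambda>i. norm (c i)) summable_on UNIV
                              \<and> (c has_sum x) UNIV"
    and finite_J: "finite J"
    and \<rho>_cont: "\<And>j. j \<in> J \<Longrightarrow> continuous_on UNIV (\<rho> j)"
    and \<rho>_cases: "\<And>j. j \<in> J \<Longrightarrow> is_seminorm (\<rho> j) \<or> linear (\<rho> j)"
  shows
    "(\<exists>K>0. \<exists>\<gamma> :: 'a \<Rightarrow> ('i, 'a) ell1.
        range \<gamma> \<subseteq> ell1_cone C \<and> continuous_on UNIV \<gamma> \<and> pos_homogeneous \<gamma> \<and>
        (\<forall>i. continuous_on UNIV (\<lambda>x. ell1_nth (\<gamma> x) i) \<and>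
             pos_homogeneous (\<lambda>x. ell1_nth (\<gamma> x) i)) \<and>
        (\<forall>x. ((\<lambda>i. ell1_nth (\<gamma> x) i) has_sum x) UNIV) \<and>
        (\<forall>x. (\<Sum>\<^sub>\<infinity>i. norm (ell1_nth (\<gamma> x) i)) \<le> K * norm x))
     \<and>
     (\<forall>(K::real) (\<alpha> :: 'j \<Rightarrow> real). K > 0 \<longrightarrow>
       ((\<forall>\<epsilon>>0. \<exists>\<gamma> :: 'a \<Rightarrow> ('i, 'a) ell1.
           \<gamma> ` sphere 0 1 \<subseteq> ell1_cone C \<and>
           (\<forall>x\<in>sphere 0 1. ((\<lambda>i. ell1_nth (\<gamma> x) i) has_sum x) UNIV) \<and>
           (\<forall>x\<in>sphere 0 1. (\<Sum>\<^sub>\<infinity>i. norm (ell1_nth (\<gamma> x) i)) \<le> K + \<epsilon>) \<and>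
           (\<forall>x\<in>sphere 0 1. \<forall>j\<in>J. \<rho> j (\<gamma> x) \<le> \<alpha> j + \<epsilon>))
        \<longleftrightarrow>
        (\<forall>\<epsilon>>0. \<exists>\<gamma> :: 'a \<Rightarrow> ('i, 'a) ell1.
           range \<gamma> \<subseteq> ell1_cone C \<and> continuous_on UNIV \<gamma> \<and> pos_homogeneous \<gamma> \<and>
           (\<forall>i. continuous_on UNIV (\<lambda>x. ell1_nth (\<gamma> x) i) \<and>
                pos_homogeneous (\<lambda>x. ell1_nth (\<gamma> x) i)) \<and>
           (\<forall>x. ((\<lambda>i. ell1_nth (\<gamma> x) i) has_sum x) UNIV) \<and>
           (\<forall>x. (\<Sum>\<^sub>\<infinity>i. norm (ell1_nth (\<gamma> x) i)) \<le> (K + \<epsilon>) * norm x) \<and>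
           (\<forall>x. \<forall>j\<in>J. \<rho> j (\<gamma> x) \<le> (\<alpha> j + \<epsilon>) * norm x))))"
proof -
  let ?T = "ell1_sum :: ('i, 'a) ell1 \<Rightarrow> 'a" and ?D = "ell1_cone C"
  define decomposes where "decomposes \<gamma> \<longleftrightarrow>
        range \<gamma> \<subseteq> ?D \<and> continuous_on UNIV \<gamma> \<and> pos_homogeneous \<gamma> \<and>
        (\<forall>i. continuous_on UNIV (\<lambda>x. ell1_nth (\<gamma> x) i) \<and>
             pos_homogeneous (\<lambda>x. ell1_nth (\<gamma> x) i)) \<and>
        (\<forall>x. ((\<lambda>i. ell1_nth (\<gamma> x) i) has_sum x) UNIV)" for \<gamma> :: "'a \<Rightarrow> ('i, 'a) ell1"
  have surj: "?T ` ?D = UNIV"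
  proof (intro equalityI subsetI UNIV_I)
    fix x
    obtain c where c: "\<And>i. c i \<in> C i" "(\<lambda>i. norm (c i)) summable_on UNIV" "(c has_sum x) UNIV"
      using decomposition[of x] by blast
    have "?T (Abs_ell1 c) = x" "Abs_ell1 c \<in> ?D"
      using c by (auto simp: has_sum_ell1_nth_iff[symmetric] ell1_cone_def ell1_nth_Abs)
    then show "x \<in> ?T ` ?D" by blast
  qed
  have D: "closed ?D" "additive_cone ?D" "0 \<in> ?D"
  proof -
    show "closed ?D" "additive_cone ?D"
      using closed_C cone_C by (auto intro: closed_ell1_cone additive_cone_ell1_cone)
    then obtain y where "y \<in> ?D" using surj by blast
    then have "0 *\<^sub>R y \<in> ?D"
      using \<open>additive_cone ?D\<close> unfolding additive_cone_def cone_def by blast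
    then show "0 \<in> ?D" by simp
  qed
  have decomposesI: "decomposes \<gamma>"
    if "continuous_on UNIV \<gamma>" "pos_homogeneous \<gamma>" "\<And>x. \<gamma> x \<in> ?D" "\<And>x. ?T (\<gamma> x) = x" for \<gamma>
    using that unfolding decomposes_def
    by (auto simp: has_sum_ell1_nth_iff pos_homogeneous_ell1_nth
        intro: bounded_linear.continuous_on[OF bounded_linear_ell1_nth])
  have part1: "\<exists>K>0. \<exists>\<gamma>. decomposes \<gamma> \<and> (\<forall>x. norm (\<gamma> x) \<le> K * norm x)"
  proof -
    obtain L where L: "0 < L"
      "\<And>s. norm s = 1 \<Longrightarrow> \<exists>c\<in>?D. norm c \<le> L \<and> norm (?T c - s) \<le> 1 / 2"
      using surjective_on_cone_approximate_preimages[OF bounded_linear_ell1_sum D(2) surj] by blast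
    then obtain g where g: "\<And>s. norm s = 1 \<Longrightarrow> g s \<in> ?D"
      "\<And>s. norm s = 1 \<Longrightarrow> norm (g s) \<le> L" "\<And>s. norm s = 1 \<Longrightarrow> norm (?T (g s) - s) \<le> 1 / 2"
      by metis
    \<comment> \<open>Approximate preimages of error 1/2 and a mesh of 1/4 leave a total error of 3/4, below 1. No
      functionals are to be controlled, so the family of functionals is empty.\<close>
    have quarter: "0 \<le> L" "0 \<le> 1 / (2 :: real)" "0 < 1 / (4 :: real)" "1 / 2 + 1 / 4 < (1 :: real)"
      using L(1) by auto
    show ?thesis
    proof (rule continuous_right_inverse_in_cone[OF bounded_linear_ell1_sum D g quarter,
          of "{}" "\<lambda>_ _. 0" 0 "\<lambda>_. 0"])
      fix \<gamma> assume "continuous_on UNIV \<gamma>" "pos_homogeneous \<gamma>" "\<And>x. \<gamma> x \<in> ?D" "\<And>x. ?T (\<gamma> x) = x"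
        "\<And>x. norm (\<gamma> x) \<le> L / (1 - (1 / 2 + 1 / 4)) * norm x"
      then show ?thesis
        using L(1) by (intro exI[of _ "L / (1 - (1 / 2 + 1 / 4))"] exI[of _ \<gamma>] conjI decomposesI) simp_all
    qed simp_all
  qed
  have sub: "sublinear (\<rho> j)" if "j \<in> J" for j
    using \<rho>_cases[OF that] by (rule sublinear_seminorm_or_linear)
  obtain M where M: "0 \<le> M" "\<And>j y. j \<in> J \<Longrightarrow> \<rho> j y \<le> M * norm y"
  proof -
    have "\<exists>M\<ge>0. \<forall>y. \<rho> j y \<le> M * norm y" if "j \<in> J" for j
      using continuous_sublinear_bounded[OF sub[OF that] \<rho>_cont[OF that]] by metis
    then obtain m where m: "\<And>j. j \<in> J \<Longrightarrow> 0 \<le> m j" "\<And>j y. j \<in> J \<Longrightarrow> \<rho> j y \<le> m j * norm y"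
      by metis
    show thesis
    proof (rule that[of "sum m J"])
      fix j and y :: "('i, 'a) ell1" assume "j \<in> J"
      then have "m j \<le> sum m J" using finite_J m(1) by (intro member_le_sum) auto
      then have "m j * norm y \<le> sum m J * norm y" by (rule mult_right_mono) simp
      then show "\<rho> j y \<le> sum m J * norm y" using m(2)[OF \<open>j \<in> J\<close>, of y] by linarith
    qed (use m in \<open>auto intro: sum_nonneg\<close>)
  qed
  have part2: "\<exists>\<gamma>. decomposes \<gamma> \<and> (\<forall>x. norm (\<gamma> x) \<le> (K + \<epsilon>) * norm x) \<and>
      (\<forall>x. \<forall>j\<in>J. \<rho> j (\<gamma> x) \<le> (\<alpha> j + \<epsilon>) * norm x)"
    if "K > 0" "\<epsilon> > 0" and g: "\<And>s. norm s = 1 \<Longrightarrow> g s \<in> ?D" "\<And>s. norm s = 1 \<Longrightarrow> ?T (g s) = s"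
      "\<And>s. norm s = 1 \<Longrightarrow> norm (g s) \<le> K + \<epsilon> / 2"
      "\<And>j s. j \<in> J \<Longrightarrow> norm s = 1 \<Longrightarrow> \<rho> j (g s) \<le> \<alpha> j + \<epsilon> / 2"
    for K \<epsilon> :: real and \<alpha> :: "'j \<Rightarrow> real" and g
  proof -
    \<comment> \<open>Half of \<open>\<epsilon>\<close> is already spent by \<open>g\<close>. As \<open>\<delta> \<le> 1 / 2\<close>, the correction adds at most
      \<open>2 * L * \<delta>\<close> to the norm and \<open>2 * M * L * \<delta>\<close> to the functionals, and \<open>\<delta>\<close> is chosen so that
      the sum of both is at most the other half.\<close>
    define L where "L = K + \<epsilon> / 2"
    define \<delta> where "\<delta> = min (1 / 2) (\<epsilon> / (4 * L * (1 + M)))"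
    have L: "L > 0" using that(1,2) by (simp add: L_def)
    have \<delta>: "0 < \<delta>" "\<delta> \<le> 1 / 2" "\<delta> \<le> \<epsilon> / (4 * L * (1 + M))"
      using L M(1) \<open>\<epsilon> > 0\<close> by (auto simp: \<delta>_def)
    have "L * \<delta> / (1 - \<delta>) \<le> L * \<delta> / (1 / 2)"
      using L \<delta> by (intro divide_left_mono) auto
    then have "(1 + M) * (L * \<delta> / (1 - \<delta>)) \<le> (1 + M) * (2 * L * \<delta>)"
      using M(1) by (intro mult_left_mono) auto
    also have "\<dots> = 2 * L * (1 + M) * \<delta>" by simp
    also have "\<dots> \<le> \<epsilon> / 2"
    proof -
      have "0 < 4 * L * (1 + M)" using L M(1) by simp
      then have "\<delta> * (4 * L * (1 + M)) \<le> \<epsilon>"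
        using \<delta>(3) by (simp only: pos_le_divide_eq)
      then show ?thesis by (simp add: algebra_simps)
    qed
    finally have err: "L * \<delta> / (1 - \<delta>) + M * L * \<delta> / (1 - \<delta>) \<le> \<epsilon> / 2"
      by (simp add: add_divide_distrib distrib_right mult.assoc)
    have nonneg: "0 \<le> L * \<delta> / (1 - \<delta>)" "0 \<le> M * L * \<delta> / (1 - \<delta>)"
      using L M(1) \<delta> by auto
    have "L / (1 - \<delta>) = L + L * \<delta> / (1 - \<delta>)"
      using \<delta> by (simp add: field_simps)
    then have bounds: "L / (1 - \<delta>) \<le> K + \<epsilon>" "\<epsilon> / 2 + M * L * \<delta> / (1 - \<delta>) \<le> \<epsilon>"
      using err nonneg L_def by linarith+
    have g_L: "norm (g s) \<le> L" and g_T: "norm (?T (g s) - s) \<le> 0" if "norm s = 1" for s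
      using g(2,3)[OF that] by (simp_all add: L_def)
    have \<delta>': "0 \<le> L" "0 \<le> (0 :: real)" "0 < \<delta>" "0 + \<delta> < 1"
      using L \<delta> by auto
    show ?thesis
    proof (rule continuous_right_inverse_in_cone[OF bounded_linear_ell1_sum D g(1) g_L g_T \<delta>'
          sub \<rho>_cont M(2,1) g(4)])
      fix \<gamma> assume \<gamma>: "continuous_on UNIV \<gamma>" "pos_homogeneous \<gamma>" "\<And>x. \<gamma> x \<in> ?D" "\<And>x. ?T (\<gamma> x) = x"
        and \<gamma>_norm: "\<And>x. norm (\<gamma> x) \<le> L / (1 - (0 + \<delta>)) * norm x"
        and \<gamma>_\<rho>: "\<And>j x. j \<in> J \<Longrightarrow>
            \<rho> j (\<gamma> x) \<le> (\<alpha> j + \<epsilon> / 2 + M * L * (0 + \<delta>) / (1 - (0 + \<delta>))) * norm x"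
      show ?thesis
      proof (intro exI[of _ \<gamma>] conjI allI ballI)
        show "decomposes \<gamma>" using \<gamma> by (rule decomposesI)
        fix x
        show "norm (\<gamma> x) \<le> (K + \<epsilon>) * norm x"
          using order_trans[OF \<gamma>_norm mult_right_mono[OF _ norm_ge_zero]] bounds(1) by simp
        fix j assume j: "j \<in> J"
        have "\<rho> j (\<gamma> x) \<le> (\<alpha> j + \<epsilon> / 2 + M * L * (0 + \<delta>) / (1 - (0 + \<delta>))) * norm x"
          using j by (rule \<gamma>_\<rho>)
        also have "\<dots> \<le> (\<alpha> j + \<epsilon>) * norm x"
          using bounds(2) by (intro mult_right_mono) auto
        finally show "\<rho> j (\<gamma> x) \<le> (\<alpha> j + \<epsilon>) * norm x" .
      qed
    qed
  qed
  show ?thesis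
    unfolding norm_ell1_def[symmetric]
  proof (intro conjI allI impI iffI)
    show "\<exists>K>0. \<exists>\<gamma>. range \<gamma> \<subseteq> ?D \<and> continuous_on UNIV \<gamma> \<and> pos_homogeneous \<gamma> \<and>
        (\<forall>i. continuous_on UNIV (\<lambda>x. ell1_nth (\<gamma> x) i) \<and>
             pos_homogeneous (\<lambda>x. ell1_nth (\<gamma> x) i)) \<and>
        (\<forall>x. ((\<lambda>i. ell1_nth (\<gamma> x) i) has_sum x) UNIV) \<and>
        (\<forall>x. norm (\<gamma> x) \<le> K * norm x)"
      using part1 by (simp only: decomposes_def conj_assoc)
  next
    fix K :: real and \<alpha> :: "'j \<Rightarrow> real" and \<epsilon> :: real
    assume K: "K > 0" "\<epsilon> > 0" and sphere: "\<forall>\<epsilon>>0. \<exists>\<gamma> :: 'a \<Rightarrow> ('i, 'a) ell1.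
           \<gamma> ` sphere 0 1 \<subseteq> ell1_cone C \<and>
           (\<forall>x\<in>sphere 0 1. ((\<lambda>i. ell1_nth (\<gamma> x) i) has_sum x) UNIV) \<and>
           (\<forall>x\<in>sphere 0 1. norm (\<gamma> x) \<le> K + \<epsilon>) \<and>
           (\<forall>x\<in>sphere 0 1. \<forall>j\<in>J. \<rho> j (\<gamma> x) \<le> \<alpha> j + \<epsilon>)"
    obtain g :: "'a \<Rightarrow> ('i, 'a) ell1" where g: "g ` sphere 0 1 \<subseteq> ell1_cone C"
        "\<forall>x\<in>sphere 0 1. ((\<lambda>i. ell1_nth (g x) i) has_sum x) UNIV"
        "\<forall>x\<in>sphere 0 1. norm (g x) \<le> K + \<epsilon> / 2"
        "\<forall>x\<in>sphere 0 1. \<forall>j\<in>J. \<rho> j (g x) \<le> \<alpha> j + \<epsilon> / 2"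
      using sphere[rule_format, of "\<epsilon> / 2"] K(2) by auto
    have "\<exists>\<gamma>. decomposes \<gamma> \<and> (\<forall>x. norm (\<gamma> x) \<le> (K + \<epsilon>) * norm x) \<and>
      (\<forall>x. \<forall>j\<in>J. \<rho> j (\<gamma> x) \<le> (\<alpha> j + \<epsilon>) * norm x)"
      by (rule part2[OF K, of g]) (use g in \<open>auto simp: has_sum_ell1_nth_iff\<close>)
    then show "\<exists>\<gamma>. range \<gamma> \<subseteq> ?D \<and> continuous_on UNIV \<gamma> \<and> pos_homogeneous \<gamma> \<and>
        (\<forall>i. continuous_on UNIV (\<lambda>x. ell1_nth (\<gamma> x) i) \<and>
             pos_homogeneous (\<lambda>x. ell1_nth (\<gamma> x) i)) \<and>
        (\<forall>x. ((\<lambda>i. ell1_nth (\<gamma> x) i) has_sum x) UNIV) \<and>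
        (\<forall>x. norm (\<gamma> x) \<le> (K + \<epsilon>) * norm x) \<and>
        (\<forall>x. \<forall>j\<in>J. \<rho> j (\<gamma> x) \<le> (\<alpha> j + \<epsilon>) * norm x)"
      by (simp only: decomposes_def conj_assoc)
  next
    fix K :: real and \<alpha> :: "'j \<Rightarrow> real" and \<epsilon> :: real
    assume "\<epsilon> > 0" and "\<forall>\<epsilon>>0. \<exists>\<gamma>. range \<gamma> \<subseteq> ?D \<and> continuous_on UNIV \<gamma> \<and> pos_homogeneous \<gamma> \<and>
        (\<forall>i. continuous_on UNIV (\<lambda>x. ell1_nth (\<gamma> x) i) \<and>
             pos_homogeneous (\<lambda>x. ell1_nth (\<gamma> x) i)) \<and>
        (\<forall>x. ((\<lambda>i. ell1_nth (\<gamma> x) i) has_sum x) UNIV) \<and>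
        (\<forall>x. norm (\<gamma> x) \<le> (K + \<epsilon>) * norm x) \<and>
        (\<forall>x. \<forall>j\<in>J. \<rho> j (\<gamma> x) \<le> (\<alpha> j + \<epsilon>) * norm x)"
    then obtain \<gamma> where \<gamma>: "range \<gamma> \<subseteq> ?D"
        "\<And>x. ((\<lambda>i. ell1_nth (\<gamma> x) i) has_sum x) UNIV"
        "\<And>x. norm (\<gamma> x) \<le> (K + \<epsilon>) * norm x"
        "\<And>x j. j \<in> J \<Longrightarrow> \<rho> j (\<gamma> x) \<le> (\<alpha> j + \<epsilon>) * norm x"
      by metis
    show "\<exists>\<gamma>. \<gamma> ` sphere 0 1 \<subseteq> ?D \<and>
           (\<forall>x\<in>sphere 0 1. ((\<lambda>i. ell1_nth (\<gamma> x) i) has_sum x) UNIV) \<and>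
           (\<forall>x\<in>sphere 0 1. norm (\<gamma> x) \<le> K + \<epsilon>) \<and>
           (\<forall>x\<in>sphere 0 1. \<forall>j\<in>J. \<rho> j (\<gamma> x) \<le> \<alpha> j + \<epsilon>)"
    proof (intro exI[of _ \<gamma>] conjI ballI)
      fix x :: 'a assume "x \<in> sphere 0 1"
      then have x: "norm x = 1" by simp
      show "norm (\<gamma> x) \<le> K + \<epsilon>" using \<gamma>(3)[of x] x by simp
      show "\<rho> j (\<gamma> x) \<le> \<alpha> j + \<epsilon>" if "j \<in> J" for j using \<gamma>(4)[OF that, of x] x by simp
    qed (use \<gamma> in auto)
  qed
qed

end
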